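(* Let $n\ge1$ be an integer. Consider the following two statements. (D) For every $\lambda\in(0,1)$, every real $p\ge1$ and all bounded sets $K,L\subset\mathbb{R}^n$ with $\mathrm{G}_n(K)\,\mathrm{G}_n(L)>0$, $$\mathrm{G}_n\bigl((1-\lambda)\cdot K+_p\lambda\cdot L+(-1,1)^n\bigr)^{p/n}\geq(1-\lambda)\,\mathrm{G}_n(K)^{p/n}+\lambda\,\mathrm{G}_n(L)^{p/n}.$$ (C) For every $\lambda\in(0,1)$, every real $p\ge1$ and all $n$-dimensional convex bodies $K,L\subset\mathbb{R}^n$, $$\mathrm{vol}\bigl((1-\lambda)\cdot K+_p\lambda\cdot L\bigr)^{p/n}\geq(1-\lambda)\,\mathrm{vol}(K)^{p/n}+\lambda\,\mathrm{vol}(L)^{p/n}.$$ Then (D) implies (C).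
   Context: $\mathrm{vol}$ is $n$-dimensional Lebesgue measure on $\mathbb{R}^n$. For $M\subset\mathbb{R}^n$, $\mathrm{G}_n(M)=|M\cap\mathbb{Z}^n|$ is the lattice point enumerator. A convex body is a nonempty compact convex set; it is $n$-dimensional if it has nonempty interior. The symbol $+$ between sets is Minkowski addition, $A+B=\{a+b: a\in A,\ b\in B\}$, and $rA=\{ra:a\in A\}$ for $r\ge 0$. For real $p\ge 1$ let $q\in(1,\infty]$ be its Hölder conjugate, $1/p+1/q=1$. For arbitrary $A,B\subset\mathbb{R}^n$ the $p$-sum is $$A+_pB=\bigl\{(1-\mu)^{1/q}x+\mu^{1/q}y:\ x\in A,\ y\in B,\ 0\le\mu\le1\bigr\},$$ where for $p=1$ (so $q=\infty$) the coefficients $(1-\mu)^{1/q}$ and $\mu^{1/q}$ are understood to be $1$ for all $\mu\in[0,1]$, so that $A+_1B=A+B$. The $p$-scalar multiplication is $r\cdot A=r^{1/p}A$ for $r\ge0$ (the dependence on $p$ is suppressed), and $r\cdot A+_p s\cdot B$ means $(r\cdot A)+_p(s\cdot B)$. *)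

theory Defs
  imports "HOL-Analysis.Analysis" "HOL-Library.Set_Algebras"
begin

definition integer_lattice :: "(real ^ 'n) set"
  where "integer_lattice = {x. \<forall>i. x $ i \<in> \<int>}"

text \<open>Since \<open>card\<close> is 0 on infinite sets, this is the lattice point enumerator only for sets
  with finitely many lattice points, in particular for bounded sets.\<close>

definition lattice_point_enumerator :: "(real ^ 'n) set \<Rightarrow> nat"
  where "lattice_point_enumerator M = card (M \<inter> integer_lattice)"

definition convex_body :: "'a::euclidean_space set \<Rightarrow> bool"
  where "convex_body K \<longleftrightarrow> K \<noteq> {} \<and> compact K \<and> convex K"

text \<open>\<open>p_coeff p t\<close> is \<open>t powr (1/q)\<close> for the Hoelder conjugate \<open>q\<close> of \<open>p\<close>, i.e.
  \<open>1/q = 1 - 1/p\<close>. The case \<open>p = 1\<close> is separate because \<open>0 powr 0 = 0\<close>, whereas the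
  coefficient has to be 1 for every \<open>t\<close>.\<close>

definition p_coeff :: "real \<Rightarrow> real \<Rightarrow> real"
  where "p_coeff p t = (if p = 1 then 1 else t powr (1 - 1 / p))"

definition p_sum :: "real \<Rightarrow> 'a::real_vector set \<Rightarrow> 'a set \<Rightarrow> 'a set"
  where "p_sum p A B =
    {p_coeff p (1 - \<mu>) *\<^sub>R x + p_coeff p \<mu> *\<^sub>R y | x y \<mu>. x \<in> A \<and> y \<in> B \<and> 0 \<le> \<mu> \<and> \<mu> \<le> 1}"

definition p_scale :: "real \<Rightarrow> real \<Rightarrow> 'a::real_vector set \<Rightarrow> 'a set"
  where "p_scale p r A = (\<lambda>x. (r powr (1 / p)) *\<^sub>R x) ` A"

lemma p_coeff_conjugate:
  assumes "p > 1" "1 / p + 1 / q = 1"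
  shows "p_coeff p t = t powr (1 / q)"
proof -
  have "1 / q = 1 - 1 / p" using assms(2) by linarith
  then show ?thesis using assms(1) by (simp add: p_coeff_def)
qed

lemma p_sum_1: "p_sum 1 A B = A + B"
proof -
  have "\<exists>\<mu>::real. 0 \<le> \<mu> \<and> \<mu> \<le> 1" by (rule exI[of _ 0]) simp
  then show ?thesis by (auto simp: p_sum_def p_coeff_def set_plus_def)
qed

end

theory Submission
  imports Defs
begin

text \<open>
  The volume is the limit of normalised lattice point counts: \<open>G (r K) / r ^ n\<close> tends to
  \<open>vol K\<close> as \<open>r\<close> grows. Applying (D) to the dilates \<open>r K\<close> and \<open>r L\<close>, dividing by \<open>r ^ p\<close> and
  letting \<open>r\<close> tend to infinity therefore gives (C), once the left side of (D) is understood. The \<open>p\<close>-combination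
  commutes with dilation (\<open>p_sum_p_scale_dilate\<close>), so the set whose points are counted on the
  left side of (D) is \<open>r S + (-1,1)^n\<close>, where \<open>S\<close> is the combination of \<open>K\<close> and \<open>L\<close>. After
  rescaling by \<open>1 / r\<close> the cube has size of order \<open>1 / r\<close> and disappears in the limit.

  Each side of (D) calls for a one-sided estimate of the counts. Attach to each lattice point
  \<open>z\<close> the unit cube with lower corner \<open>z\<close>; its points have distance at most \<open>n\<close> from \<open>z\<close>. These cubes cover
  space, so the cubes of the lattice points of \<open>r K\<close> cover everything at distance at least \<open>n\<close>
  from the complement, and \<open>G (r K)\<close> is at least \<open>r ^ n\<close> times the volume of the inner parallel
  set of \<open>K\<close> at distance \<open>n / r\<close> (\<open>measure_inner_parallel_le_lattice_points\<close>). Their interiors are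
  disjoint, so \<open>G (r S + (-1,1)^n)\<close> is at most \<open>r ^ n\<close> times the volume of the outer parallel
  set of \<open>S\<close> at distance \<open>2 n / r\<close> (\<open>lattice_points_le_measure_outer_parallel\<close>).

  As \<open>r\<close> grows, the inner parallel sets increase to the interior of \<open>K\<close>, whose volume is that of
  \<open>K\<close> because the boundary of a convex set is negligible. The outer parallel sets decrease to
  \<open>S\<close>, because \<open>S\<close> is closed: it is the continuous image of a compact set (\<open>compact_p_sum\<close>).
  Continuity of the measure along monotone sequences completes the argument.
\<close>

section \<open>Lattice points and unit cubes\<close>

lemma measure_unit_cube:
  fixes z :: "real ^ 'n"
  shows "measure lebesgue (cbox z (z + 1)) = 1" and "measure lebesgue (box z (z + 1)) = 1"
proof -
  have ne: "cbox z (z + 1) \<noteq> {}"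
  proof -
    have "z \<in> cbox z (z + 1)" by (simp add: mem_box_cart)
    then show ?thesis by blast
  qed
  show c: "measure lebesgue (cbox z (z + 1)) = 1"
    using content_cbox_cart[OF ne] by simp
  have "negligible (frontier (cbox z (z + 1)))"
    by (rule negligible_convex_frontier) simp
  then show "measure lebesgue (box z (z + 1)) = 1"
    using measure_interior[of "cbox z (z + 1)"] c by simp
qed

lemma norm_le_CARD:
  fixes v :: "real ^ 'n"
  assumes "\<And>i. \<bar>v $ i\<bar> \<le> 1"
  shows "norm v \<le> real CARD('n)"
proof -
  have "norm v \<le> (\<Sum>i\<in>UNIV. \<bar>v $ i\<bar>)" by (rule norm_le_l1_cart)
  also have "\<dots> \<le> (\<Sum>i\<in>(UNIV :: 'n set). 1)" using assms by (intro sum_mono) auto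
  finally show ?thesis by simp
qed

lemma dist_unit_cube_le:
  fixes x z :: "real ^ 'n"
  assumes "x \<in> cbox z (z + 1)"
  shows "dist x z \<le> real CARD('n)"
  unfolding dist_norm
proof (intro norm_le_CARD)
  fix i
  have "z $ i \<le> x $ i" "x $ i \<le> z $ i + 1" using assms by (auto simp: mem_box_cart)
  then show "\<bar>(x - z) $ i\<bar> \<le> 1" by simp
qed

text \<open>Open unit cubes with distinct lattice corners are disjoint, so they pack into \<open>T\<close>.\<close>

lemma card_lattice_le_measure:
  fixes F :: "(real ^ 'n) set"
  assumes fin: "finite F" and F: "F \<subseteq> integer_lattice" and T: "T \<in> lmeasurable"
    and sub: "\<And>z. z \<in> F \<Longrightarrow> box z (z + 1) \<subseteq> T"
  shows "real (card F) \<le> measure lebesgue T"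
proof -
  have disj: "disjnt (box z (z + 1)) (box w (w + 1))" if "z \<in> F" "w \<in> F" "z \<noteq> w" for z w
  proof (rule ccontr)
    assume "\<not> ?thesis"
    then obtain x where x: "x \<in> box z (z + 1)" "x \<in> box w (w + 1)" by (auto simp: disjnt_def)
    have "z $ i = w $ i" for i
    proof -
      have zw: "z $ i \<in> \<int>" "w $ i \<in> \<int>" using that F by (auto simp: integer_lattice_def)
      then obtain a b where ab: "z $ i = of_int a" "w $ i = of_int b" by (auto elim!: Ints_cases)
      have "z $ i < x $ i" "x $ i < z $ i + 1" "w $ i < x $ i" "x $ i < w $ i + 1"
        using x by (auto simp: mem_box_cart)
      then have "a = b" unfolding ab by linarith
      then show ?thesis by (simp add: ab)
    qed
    with \<open>z \<noteq> w\<close> show False by (simp add: vec_eq_iff)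
  qed
  have "real (card F) = (\<Sum>z\<in>F. measure lebesgue (box z (z + 1)))"
    by (simp add: measure_unit_cube)
  also have "\<dots> = measure lebesgue (\<Union>z\<in>F. box z (z + 1))"
    using fin disj by (intro measure_UNION'[symmetric]) (auto simp: pairwise_def)
  also have "\<dots> \<le> measure lebesgue T"
    using T sub fin by (intro measure_mono_fmeasurable) auto
  finally show ?thesis .
qed

text \<open>By the packing estimate, the finite sets of lattice points of \<open>M\<close> have cardinality
  bounded by the volume of a single large ball.\<close>

lemma finite_lattice_points:
  fixes M :: "(real ^ 'n) set"
  assumes "bounded M"
  shows "finite (M \<inter> integer_lattice)"
proof -
  obtain r where r: "\<And>x. x \<in> M \<Longrightarrow> norm x \<le> r" using assms by (auto simp: bounded_iff)
  define T where "T = cball (0 :: real ^ 'n) (r + real CARD('n))"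
  have sub: "box z (z + 1) \<subseteq> T" if "z \<in> M" for z
  proof
    fix x assume "x \<in> box z (z + 1)"
    then have "dist x z \<le> real CARD('n)" using box_subset_cbox by (blast intro: dist_unit_cube_le)
    then show "x \<in> T" using r[OF that] norm_triangle_sub[of x z] by (simp add: T_def dist_norm)
  qed
  have "card G \<le> nat \<lceil>measure lebesgue T\<rceil>"
    if G: "G \<subseteq> M \<inter> integer_lattice" "finite G" for G
  proof -
    have "real (card G) \<le> measure lebesgue T"
      using G sub by (intro card_lattice_le_measure) (auto simp: T_def)
    then show ?thesis by linarith
  qed
  then show ?thesis using finite_if_finite_subsets_card_bdd by blast
qed

lemma measure_le_card_lattice:
  fixes F :: "(real ^ 'n) set"
  assumes fin: "finite F" and T: "T \<in> lmeasurable" and sub: "T \<subseteq> (\<Union>z\<in>F. cbox z (z + 1))"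
  shows "measure lebesgue T \<le> real (card F)"
proof -
  have "measure lebesgue T \<le> measure lebesgue (\<Union>z\<in>F. cbox z (z + 1))"
    using T sub fin by (intro measure_mono_fmeasurable) auto
  also have "\<dots> \<le> (\<Sum>z\<in>F. measure lebesgue (cbox z (z + 1)))"
    using fin by (intro measure_UNION_le) auto
  finally show ?thesis by (simp add: measure_unit_cube)
qed

lemma unit_cubes_cover:
  fixes x :: "real ^ 'n"
  obtains z where "z \<in> integer_lattice" "x \<in> cbox z (z + 1)"
proof
  show "(\<chi> i. of_int \<lfloor>x $ i\<rfloor>) \<in> integer_lattice" by (simp add: integer_lattice_def)
  show "x \<in> cbox (\<chi> i. of_int \<lfloor>x $ i\<rfloor>) ((\<chi> i. of_int \<lfloor>x $ i\<rfloor>) + 1)"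
    by (auto simp: mem_box_cart intro: less_imp_le)
qed

section \<open>Parallel sets\<close>

definition inner_parallel :: "'a::metric_space set \<Rightarrow> real \<Rightarrow> 'a set"
  where "inner_parallel K d = {x. cball x d \<subseteq> K}"

definition outer_parallel :: "'a::metric_space set \<Rightarrow> real \<Rightarrow> 'a set"
  where "outer_parallel S d = {x. infdist x S \<le> d}"

text \<open>The inner parallel set is an intersection of translates of \<open>K\<close>, hence closed.\<close>

lemma compact_inner_parallel:
  fixes K :: "'a::euclidean_space set"
  assumes "compact K" "0 \<le> d"
  shows "compact (inner_parallel K d)"
proof -
  have "inner_parallel K d = (\<Inter>v\<in>cball (0::'a) d. (+) (- v) ` K)"
  proof (intro set_eqI iffI)
    fix x assume x: "x \<in> inner_parallel K d"
    show "x \<in> (\<Inter>v\<in>cball 0 d. (+) (- v) ` K)"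
    proof
      fix v :: 'a assume "v \<in> cball 0 d"
      then have "x + v \<in> K" using x by (auto simp: inner_parallel_def dist_norm subset_iff)
      then show "x \<in> (+) (- v) ` K" by (intro image_eqI[of _ _ "x + v"]) auto
    qed
  next
    fix x assume x: "x \<in> (\<Inter>v\<in>cball 0 d. (+) (- v) ` K)"
    have "y \<in> K" if "dist x y \<le> d" for y
    proof -
      have "y - x \<in> cball 0 d" using that by (simp add: dist_norm norm_minus_commute)
      then obtain k where "k \<in> K" "x = - (y - x) + k" using x by blast
      then show ?thesis by simp
    qed
    then show "x \<in> inner_parallel K d" by (auto simp: inner_parallel_def)
  qed
  then have "closed (inner_parallel K d)"
    by (simp only:) (intro closed_INT ballI closed_translation compact_imp_closed assms)
  moreover have "inner_parallel K d \<subseteq> K" using assms(2) by (auto simp: inner_parallel_def)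
  ultimately show ?thesis using assms(1) by (metis compact_Int_closed inf.absorb2)
qed

text \<open>The interior cannot be replaced by \<open>K\<close> here: a compact set may have a boundary of positive
  measure, and no inner parallel set meets the boundary.\<close>

lemma tendsto_measure_inner_parallel:
  fixes K :: "'a::euclidean_space set"
  assumes K: "compact K" and c: "0 < c"
  shows "(\<lambda>k. measure lebesgue (inner_parallel K (c / real (Suc k))))
           \<longlonglongrightarrow> measure lebesgue (interior K)"
proof -
  let ?A = "\<lambda>k. inner_parallel K (c / real (Suc k))"
  have un: "(\<Union>k. ?A k) = interior K"
  proof (intro set_eqI iffI)
    fix x assume "x \<in> (\<Union>k. ?A k)"
    then obtain k where "cball x (c / real (Suc k)) \<subseteq> K" by (auto simp: inner_parallel_def)
    then show "x \<in> interior K" using c unfolding mem_interior_cball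
      by (intro exI[of _ "c / real (Suc k)"]) auto
  next
    fix x assume "x \<in> interior K"
    then obtain e where e: "e > 0" "cball x e \<subseteq> K" unfolding mem_interior_cball by blast
    obtain k where "inverse (real (Suc k)) < e / c"
      using reals_Archimedean[of "e / c"] e c by auto
    then have "c / real (Suc k) \<le> e" using c by (simp add: field_simps)
    then show "x \<in> (\<Union>k. ?A k)" using e subset_cball[of "c / real (Suc k)" e x]
      by (auto simp: inner_parallel_def)
  qed
  have "incseq ?A"
  proof (rule incseq_SucI)
    fix k
    have "c / real (Suc (Suc k)) \<le> c / real (Suc k)" using c by (intro divide_left_mono) auto
    then show "?A k \<le> ?A (Suc k)" unfolding inner_parallel_def using subset_cball by blast
  qed
  moreover have "range ?A \<subseteq> sets lebesgue"
    using compact_inner_parallel[OF K] c by (auto intro!: lmeasurable_compact fmeasurableD)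
  moreover have "interior K \<in> lmeasurable" using K
    by (intro lmeasurable_open) (auto intro: bounded_interior compact_imp_bounded)
  then have "emeasure lebesgue (\<Union>k. ?A k) \<noteq> \<infinity>" unfolding un using fmeasurableD2 by (metis infinity_ennreal_def)
  ultimately show ?thesis using Lim_measure_incseq[of ?A lebesgue] un by simp
qed

lemma tendsto_measure_outer_parallel:
  fixes S :: "'a::euclidean_space set"
  assumes S: "compact S" "S \<noteq> {}" and c: "0 < c"
  shows "(\<lambda>k. measure lebesgue (outer_parallel S (c / real (Suc k)))) \<longlonglongrightarrow> measure lebesgue S"
proof -
  let ?A = "\<lambda>k. outer_parallel S (c / real (Suc k))"
  have int: "(\<Inter>k. ?A k) = S"
  proof (intro set_eqI iffI)
    fix x assume x: "x \<in> (\<Inter>k. ?A k)"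
    have "(\<lambda>k. c * inverse (real (Suc k))) \<longlonglongrightarrow> c * 0"
      by (intro tendsto_mult_left LIMSEQ_inverse_real_of_nat)
    moreover have "infdist x S \<le> c * inverse (real (Suc k))" for k
      using x by (auto simp: outer_parallel_def divide_inverse)
    ultimately have "infdist x S \<le> c * 0" by (meson LIMSEQ_le_const)
    then show "x \<in> S" using infdist_nonneg[of x S] S
      by (simp add: in_closed_iff_infdist_zero compact_imp_closed)
  next
    fix x assume "x \<in> S"
    then show "x \<in> (\<Inter>k. ?A k)" using c by (auto simp: outer_parallel_def)
  qed
  have meas: "?A k \<in> lmeasurable" for k
    unfolding outer_parallel_def using S c by (intro lmeasurable_compact compact_infdist_le) auto
  have "decseq ?A"
  proof (rule decseq_SucI)
    fix k
    have "c / real (Suc (Suc k)) \<le> c / real (Suc k)" using c by (intro divide_left_mono) auto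
    then show "?A (Suc k) \<le> ?A k" unfolding outer_parallel_def by auto
  qed
  moreover have "range ?A \<subseteq> sets lebesgue" using meas by (auto intro: fmeasurableD)
  moreover have "emeasure lebesgue (?A k) \<noteq> \<infinity>" for k using meas[of k] fmeasurableD2 by (metis infinity_ennreal_def)
  ultimately show ?thesis using Lim_measure_decseq[of ?A lebesgue] int by simp
qed

section \<open>Lattice points of large dilates\<close>

lemma measure_dilate:
  fixes S :: "(real ^ 'n) set"
  assumes "0 < r"
  shows "measure lebesgue ((*\<^sub>R) r ` S) = r ^ CARD('n) * measure lebesgue S"
  using measure_lebesgue_affine[of r 0 S] assms by simp

text \<open>If \<open>x\<close> lies in the \<open>r\<close>-dilate of the inner parallel set, then the corner of the unit cube that
  contains \<open>x\<close> is at distance at most \<open>n\<close> from \<open>x\<close>, so it still belongs to \<open>r K\<close>.\<close>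

lemma measure_inner_parallel_le_lattice_points:
  fixes K :: "(real ^ 'n) set"
  assumes K: "compact K" and r: "0 < r"
  shows "r ^ CARD('n) * measure lebesgue (inner_parallel K (real CARD('n) / r))
           \<le> real (lattice_point_enumerator ((*\<^sub>R) r ` K))"
proof -
  define T where "T = (*\<^sub>R) r ` inner_parallel K (real CARD('n) / r)"
  define F where "F = (*\<^sub>R) r ` K \<inter> integer_lattice"
  have "T \<subseteq> (\<Union>z\<in>F. cbox z (z + 1))"
  proof
    fix x assume "x \<in> T"
    then obtain y where y: "x = r *\<^sub>R y" "cball y (real CARD('n) / r) \<subseteq> K"
      by (auto simp: T_def inner_parallel_def)
    obtain z where z: "z \<in> integer_lattice" "x \<in> cbox z (z + 1)" by (rule unit_cubes_cover)
    have "dist y (z /\<^sub>R r) = norm ((1 / r) *\<^sub>R (x - z))"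
      using r y by (simp add: dist_norm scaleR_diff_right divide_inverse)
    also have "\<dots> = dist x z / r" using r by (simp add: dist_norm)
    also have "\<dots> \<le> real CARD('n) / r"
      using dist_unit_cube_le[OF z(2)] r by (intro divide_right_mono) auto
    finally have "z /\<^sub>R r \<in> K" using y(2) by auto
    then have "z \<in> (*\<^sub>R) r ` K" using r by (intro image_eqI[of _ _ "z /\<^sub>R r"]) auto
    then show "x \<in> (\<Union>z\<in>F. cbox z (z + 1))" using z by (auto simp: F_def)
  qed
  moreover have "T \<in> lmeasurable" unfolding T_def
    using K r by (intro lmeasurable_compact compact_scaling compact_inner_parallel) auto
  moreover have "finite F" unfolding F_def
    using K by (intro finite_lattice_points compact_imp_bounded compact_scaling)
  ultimately have "measure lebesgue T \<le> real (card F)" by (intro measure_le_card_lattice)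
  then show ?thesis unfolding T_def F_def lattice_point_enumerator_def
    by (simp add: measure_dilate[OF r])
qed

text \<open>The distance \<open>2 n\<close> is the sum of two contributions: a point of a unit cube is at distance at
  most \<open>n\<close> from its corner \<open>z\<close>, and \<open>z\<close> is at distance at most \<open>n\<close> from \<open>r S\<close>, because it differs
  from a point of \<open>r S\<close> by an element of \<open>(-1,1)^n\<close>.\<close>

lemma lattice_points_le_measure_outer_parallel:
  fixes S :: "(real ^ 'n) set"
  assumes S: "compact S" "S \<noteq> {}" and r: "0 < r"
  shows "real (lattice_point_enumerator ((*\<^sub>R) r ` S + box (- 1) 1))
           \<le> r ^ CARD('n) * measure lebesgue (outer_parallel S (2 * real CARD('n) / r))"
proof -
  define T where "T = (*\<^sub>R) r ` outer_parallel S (2 * real CARD('n) / r)"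
  define F where "F = ((*\<^sub>R) r ` S + box (- 1) 1) \<inter> integer_lattice"
  have "box z (z + 1) \<subseteq> T" if "z \<in> F" for z
  proof
    fix x assume "x \<in> box z (z + 1)"
    then have xz: "dist x z \<le> real CARD('n)"
      using box_subset_cbox by (blast intro: dist_unit_cube_le)
    obtain s b where s: "s \<in> S" "z = r *\<^sub>R s + b" "b \<in> box (- 1) 1"
      using \<open>z \<in> F\<close> by (auto simp: F_def elim!: set_plus_elim)
    have "norm b \<le> real CARD('n)"
    proof (intro norm_le_CARD)
      fix i
      have "- 1 < b $ i" "b $ i < 1" using s(3) by (auto simp: mem_box_cart)
      then show "\<bar>b $ i\<bar> \<le> 1" by simp
    qed
    then have "dist z (r *\<^sub>R s) \<le> real CARD('n)" using s by (simp add: dist_norm)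
    then have xs: "dist x (r *\<^sub>R s) \<le> 2 * real CARD('n)"
      using xz dist_triangle[of x "r *\<^sub>R s" z] by linarith
    have "dist (x /\<^sub>R r) s = norm ((1 / r) *\<^sub>R (x - r *\<^sub>R s))"
      using r by (simp add: dist_norm scaleR_diff_right divide_inverse)
    also have "\<dots> = dist x (r *\<^sub>R s) / r" using r by (simp add: dist_norm)
    also have "\<dots> \<le> 2 * real CARD('n) / r" using xs r by (intro divide_right_mono) auto
    finally have "x /\<^sub>R r \<in> outer_parallel S (2 * real CARD('n) / r)"
      using s(1) by (auto simp: outer_parallel_def intro: infdist_le2)
    then show "x \<in> T" unfolding T_def using r by (intro image_eqI[of _ _ "x /\<^sub>R r"]) auto
  qed
  moreover have "T \<in> lmeasurable" unfolding T_def outer_parallel_def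
    using S r by (intro lmeasurable_compact compact_scaling compact_infdist_le) auto
  moreover have "finite F" unfolding F_def
    using S unfolding set_plus_image
    by (intro finite_lattice_points bounded_plus bounded_box compact_imp_bounded[OF compact_scaling])
  ultimately have "real (card F) \<le> measure lebesgue T"
    by (intro card_lattice_le_measure) (auto simp: F_def)
  then show ?thesis unfolding T_def F_def lattice_point_enumerator_def
    by (simp add: measure_dilate[OF r])
qed

section \<open>Compactness and homogeneity of the p-sum\<close>

text \<open>For \<open>p > 1\<close> the exponent \<open>1 - 1 / p\<close> is positive, so the power is continuous also at \<open>0\<close>; for
  \<open>p = 1\<close> the coefficient is constant.\<close>

lemma continuous_on_p_coeff:
  assumes "1 \<le> p" "continuous_on X f" "\<And>x. x \<in> X \<Longrightarrow> 0 \<le> f x"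
  shows "continuous_on X (\<lambda>x. p_coeff p (f x))"
proof (cases "p = 1")
  case True
  then show ?thesis by (simp add: p_coeff_def)
next
  case False
  then have "1 < p" using assms(1) by simp
  then have "continuous_on X (\<lambda>x. f x powr (1 - 1 / p))"
    using assms by (intro continuous_on_powr' continuous_on_const) auto
  then show ?thesis using False by (simp add: p_coeff_def)
qed

lemma compact_p_sum:
  fixes A B :: "'a::euclidean_space set"
  assumes "1 \<le> p" "compact A" "compact B"
  shows "compact (p_sum p A B)"
proof -
  let ?f = "\<lambda>w::('a \<times> 'a) \<times> real. p_coeff p (1 - snd w) *\<^sub>R fst (fst w) + p_coeff p (snd w) *\<^sub>R snd (fst w)"
  have "p_sum p A B = ?f ` ((A \<times> B) \<times> {0..1})"
    by (force simp: p_sum_def image_iff)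
  moreover have "continuous_on ((A \<times> B) \<times> {0..1}) ?f"
    using assms(1) by (intro continuous_intros continuous_on_p_coeff) auto
  ultimately show ?thesis using assms
    by (auto intro!: compact_continuous_image compact_Times)
qed

lemma p_sum_p_scale_dilate:
  "p_sum p (p_scale p s ((*\<^sub>R) r ` K)) (p_scale p t ((*\<^sub>R) r ` L))
    = (*\<^sub>R) r ` p_sum p (p_scale p s K) (p_scale p t L)"
proof -
  have "p_sum p ((*\<^sub>R) r ` A) ((*\<^sub>R) r ` B) = (*\<^sub>R) r ` p_sum p A B" for A B :: "'a set"
  proof (intro set_eqI iffI)
    fix z assume "z \<in> p_sum p ((*\<^sub>R) r ` A) ((*\<^sub>R) r ` B)"
    then obtain x y m where "x \<in> A" "y \<in> B" "0 \<le> m" "m \<le> 1"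
      and "z = p_coeff p (1 - m) *\<^sub>R r *\<^sub>R x + p_coeff p m *\<^sub>R r *\<^sub>R y"
      unfolding p_sum_def by blast
    then show "z \<in> (*\<^sub>R) r ` p_sum p A B" unfolding p_sum_def
      by (intro image_eqI[of _ _ "p_coeff p (1 - m) *\<^sub>R x + p_coeff p m *\<^sub>R y"])
        (auto simp: scaleR_add_right mult.commute)
  next
    fix z assume "z \<in> (*\<^sub>R) r ` p_sum p A B"
    then obtain x y m where xy: "x \<in> A" "y \<in> B" "0 \<le> m" "m \<le> 1"
      and "z = r *\<^sub>R (p_coeff p (1 - m) *\<^sub>R x + p_coeff p m *\<^sub>R y)"
      unfolding p_sum_def by blast
    then have "z = p_coeff p (1 - m) *\<^sub>R r *\<^sub>R x + p_coeff p m *\<^sub>R r *\<^sub>R y"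
      by (simp add: scaleR_add_right mult.commute)
    then show "z \<in> p_sum p ((*\<^sub>R) r ` A) ((*\<^sub>R) r ` B)" using xy unfolding p_sum_def by blast
  qed
  moreover have "p_scale p c ((*\<^sub>R) r ` A) = (*\<^sub>R) r ` p_scale p c A" for c and A :: "'a set"
    by (simp add: p_scale_def image_image mult.commute)
  ultimately show ?thesis by simp
qed

lemma p_sum_nonempty:
  assumes "A \<noteq> {}" "B \<noteq> {}"
  shows "p_sum p A B \<noteq> {}"
proof -
  obtain a b where "a \<in> A" "b \<in> B" using assms by auto
  then have "p_coeff p (1 - 0) *\<^sub>R a + p_coeff p 0 *\<^sub>R b \<in> p_sum p A B"
    unfolding p_sum_def by force
  then show ?thesis by blast
qed

section \<open>From lattice points to volume\<close>

theorem theorem1p2: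
  assumes D:
    "\<forall>(t::real) (p::real). \<forall>(K :: (real ^ 'n) set) (L :: (real ^ 'n) set).
       0 < t \<and> t < 1 \<and> 1 \<le> p \<and> bounded K \<and> bounded L \<and>
       lattice_point_enumerator K * lattice_point_enumerator L > 0 \<longrightarrow>
       real (lattice_point_enumerator
           (p_sum p (p_scale p (1 - t) K) (p_scale p t L) + box (- 1) 1)) powr (p / CARD('n))
         \<ge> (1 - t) * real (lattice_point_enumerator K) powr (p / CARD('n))
           + t * real (lattice_point_enumerator L) powr (p / CARD('n))"
  shows
    "\<forall>(t::real) (p::real). \<forall>(K :: (real ^ 'n) set) (L :: (real ^ 'n) set).
       0 < t \<and> t < 1 \<and> 1 \<le> p \<and> convex_body K \<and> interior K \<noteq> {} \<and>
       convex_body L \<and> interior L \<noteq> {} \<longrightarrow>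
       measure lebesgue (p_sum p (p_scale p (1 - t) K) (p_scale p t L)) powr (p / CARD('n))
         \<ge> (1 - t) * measure lebesgue K powr (p / CARD('n))
           + t * measure lebesgue L powr (p / CARD('n))"
proof (intro allI impI)
  fix t p :: real and K L :: "(real ^ 'n) set"
  assume "0 < t \<and> t < 1 \<and> 1 \<le> p \<and> convex_body K \<and> interior K \<noteq> {} \<and>
    convex_body L \<and> interior L \<noteq> {}"
  then have t: "0 < t" "t < 1" and p: "1 \<le> p" and K: "compact K" "convex K" "interior K \<noteq> {}"
    and L: "compact L" "convex L" "interior L \<noteq> {}" by (auto simp: convex_body_def)
  define n where "n = real CARD('n)"
  define e where "e = p / n"
  define S where "S = p_sum p (p_scale p (1 - t) K) (p_scale p t L)"
  define a where "a M k = measure lebesgue (inner_parallel M (n / real (Suc k)))"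
    for M :: "(real ^ 'n) set" and k
  define s where "s k = measure lebesgue (outer_parallel S (2 * n / real (Suc k)))" for k
  have n: "0 < n" by (simp add: n_def)
  have e: "0 < e" using n p by (simp add: e_def)
  have S: "compact S" "S \<noteq> {}"
  proof -
    show "compact S" unfolding S_def p_scale_def
      using p K(1) L(1) by (intro compact_p_sum compact_scaling)
    have "K \<noteq> {}" "L \<noteq> {}" using K(3) L(3) by auto
    then show "S \<noteq> {}" unfolding S_def p_scale_def by (intro p_sum_nonempty) auto
  qed
  have a_lim: "a M \<longlonglongrightarrow> measure lebesgue M" and vol_pos: "0 < measure lebesgue M"
    if M: "compact M" "convex M" "interior M \<noteq> {}" for M
  proof -
    have "measure lebesgue (interior M) = measure lebesgue M"
      using M by (intro measure_interior negligible_convex_frontier compact_imp_bounded)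
    then show "a M \<longlonglongrightarrow> measure lebesgue M"
      using tendsto_measure_inner_parallel[OF M(1) n] unfolding a_def by simp
    have "M \<in> lmeasurable" using M(1) by (rule lmeasurable_compact)
    moreover have "\<not> negligible M"
      using M(3) open_not_negligible[OF open_interior] negligible_subset interior_subset by blast
    ultimately show "0 < measure lebesgue M"
      using negligible_iff_measure0[of M] by (simp add: order_less_le)
  qed
  have s_lim: "s \<longlonglongrightarrow> measure lebesgue S"
    unfolding s_def using n by (intro tendsto_measure_outer_parallel[OF S]) simp
  \<comment> \<open>(D) requires both sets to contain lattice points. Positivity of the inner volumes provides
    them, and it holds for all large \<open>k\<close> because the limits \<open>vol K\<close> and \<open>vol L\<close> are positive.\<close>
  have "(1 - t) * a K k powr e + t * a L k powr e \<le> s k powr e"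
    if pos: "0 < a K k" "0 < a L k" for k
  proof -
    define r where "r = real (Suc k)"
    define g where "g M = real (lattice_point_enumerator ((*\<^sub>R) r ` M))" for M :: "(real ^ 'n) set"
    define R where "R = r ^ CARD('n)"
    have r: "0 < r" by (simp add: r_def)
    then have R: "0 < R" by (simp add: R_def)
    have Kg: "R * a K k \<le> g K" and Lg: "R * a L k \<le> g L"
      using measure_inner_parallel_le_lattice_points[OF K(1) r]
        measure_inner_parallel_le_lattice_points[OF L(1) r]
      by (simp_all add: g_def R_def a_def n_def r_def)
    have "0 < g K" "0 < g L" using Kg Lg pos R by (meson less_le_trans mult_pos_pos)+
    then have *: "lattice_point_enumerator ((*\<^sub>R) r ` K) * lattice_point_enumerator ((*\<^sub>R) r ` L) > 0"
      by (simp add: g_def)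
    have "R powr e * ((1 - t) * a K k powr e + t * a L k powr e)
        = (1 - t) * (R * a K k) powr e + t * (R * a L k) powr e"
      by (simp add: powr_mult algebra_simps)
    also have "\<dots> \<le> (1 - t) * g K powr e + t * g L powr e"
      using t e R pos Kg Lg by (intro add_mono mult_left_mono powr_mono2) auto
    also have "\<dots> \<le> real (lattice_point_enumerator
        (p_sum p (p_scale p (1 - t) ((*\<^sub>R) r ` K)) (p_scale p t ((*\<^sub>R) r ` L)) + box (- 1) 1)) powr e"
      using D t p * K(1) L(1) unfolding g_def e_def n_def
      by (simp add: compact_imp_bounded compact_scaling)
    also have "\<dots> = real (lattice_point_enumerator ((*\<^sub>R) r ` S + box (- 1) 1)) powr e"
      by (simp add: p_sum_p_scale_dilate S_def)
    also have "\<dots> \<le> (R * s k) powr e"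
      using lattice_points_le_measure_outer_parallel[OF S r] e
      by (intro powr_mono2) (simp_all add: R_def s_def n_def r_def)
    also have "\<dots> = R powr e * s k powr e" by (simp add: powr_mult)
    finally show ?thesis using R by (simp add: mult_le_cancel_left_pos)
  qed
  moreover have "eventually (\<lambda>k. 0 < a K k \<and> 0 < a L k) sequentially"
    using order_tendstoD(1)[OF a_lim[OF K] vol_pos[OF K]]
      order_tendstoD(1)[OF a_lim[OF L] vol_pos[OF L]] by (rule eventually_conj)
  ultimately have ev: "eventually (\<lambda>k. (1 - t) * a K k powr e + t * a L k powr e \<le> s k powr e) sequentially"
    by (auto elim!: eventually_mono)
  have "(1 - t) * measure lebesgue K powr e + t * measure lebesgue L powr e \<le> measure lebesgue S powr e"
  proof (rule tendsto_le[OF sequentially_bot _ _ ev])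
    show "(\<lambda>k. s k powr e) \<longlonglongrightarrow> measure lebesgue S powr e"
    proof (intro tendsto_powr' s_lim tendsto_const)
      show "measure lebesgue S \<noteq> 0 \<or> 0 < e \<and> (\<forall>\<^sub>F k in sequentially. 0 \<le> s k)"
        using e by (simp add: s_def)
    qed
    show "(\<lambda>k. (1 - t) * a K k powr e + t * a L k powr e)
        \<longlonglongrightarrow> (1 - t) * measure lebesgue K powr e + t * measure lebesgue L powr e"
      using vol_pos[OF K] vol_pos[OF L]
      by (intro tendsto_add tendsto_mult tendsto_powr' tendsto_const a_lim K L) auto
  qed
  then show "measure lebesgue (p_sum p (p_scale p (1 - t) K) (p_scale p t L)) powr (p / CARD('n))
         \<ge> (1 - t) * measure lebesgue K powr (p / CARD('n))
           + t * measure lebesgue L powr (p / CARD('n))"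
    by (simp add: S_def e_def n_def)
qed

end
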